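(* Let $C,D_1,\dots,D_m$ be nonempty closed (possibly nonconvex) subsets of $\mathbb{R}^n$ with $C^\infty\cap\left(\bigcap_{i=1}^m D_i^\infty\right)=\{0\}$, let $\psi\in\Theta$, and let $\Psi(x):=\sum_{i=1}^m\psi(d_{D_i}^2(x))$. Let $\{x^t\}$, $\{\alpha_t\}$ and $\{\xi_i^t\}$, $i=1,\dots,m$, be the sequences generated by the algorithm sGP$_{ls}$ applied to $\min_{x\in C}\Psi(x)$. Then the following statements hold. (a) The sequences $\{x^t\}$ and $\{\xi_i^t\}$, $i=1,\dots,m$, are all bounded, and $\inf_{t\ge0}\alpha_t>0$. (b) $\lim_{t\to\infty}\|x^{t+1}-x^t\|=0$ and the limit $\lim_{t\to\infty}\Psi(x^t)$ exists. (c) Any cluster point of $\{x^t\}$ is a stationary point of $\Psi+\delta_C$.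
   Context: $\Theta$ denotes the set of level-bounded (i.e., $\{s\ge0:\psi(s)\le\gamma\}$ is bounded for every $\gamma\in\mathbb{R}$) continuous concave functions $\psi:\mathbb{R}_+\to\mathbb{R}_+$ such that: (1) $\psi$ is continuously differentiable on $(0,\infty)$ with positive derivative and $\psi(0)=0$; (2) $\lim_{s\downarrow0}\psi'(s)$ exists (as a real number) and is positive, and the right derivative $\psi'_+$ is Lipschitz continuous on $\mathbb{R}_+=[0,\infty)$. For a nonempty closed set $D\subseteq\mathbb{R}^n$: $d_D(x)=\inf_{y\in D}\|x-y\|$; $P_D(x)=\{y\in D:\|x-y\|=d_D(x)\}$ is the set of projections; $D^\infty:=\{x:\exists\, x^t\in D,\ \lambda_t\downarrow0\text{ with }\lambda_tx^t\to x\}$ is the horizon cone; $\delta_D$ is the indicator function ($0$ on $D$, $+\infty$ elsewhere). For a proper closed $f$ and $\bar x\in\mathrm{dom} f$, $\widehat\partial f(\bar x)=\{v:\liminf_{x\to\bar x,x\ne\bar x}\frac{f(x)-f(\bar x)-\langle v,x-\bar x\rangle}{\|x-\bar x\|}\ge0\}$ and $\partial f(\bar x)=\{v:\exists\,x^t\to\bar x,\ f(x^t)\to f(\bar x),\ v^t\in\widehat\partial f(x^t),\ v^t\to v\}$ (limiting subdifferential; empty outside $\mathrm{dom} f$). $N_C(x)=\partial\delta_C(x)$ for $x\in C$ is the (limiting) normal cone. A point $\bar x\in C$ is a stationary point of $\Psi+\delta_C$ if $0\in\sum_{i=1}^m[2\psi_+'(d_{D_i}^2(\bar x))(\bar x-P_{D_i}(\bar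 x))]+N_C(\bar x)$ (sum of sets). Algorithm sGP$_{ls}$: Choose $\alpha_{\max}>\alpha_{\min}>0$, $\eta\in(0,1)$, $\sigma>0$, an integer $M\ge0$ and $x^0\in C$. For $t=0,1,2,\dots$: choose any $\alpha_t^0\in[\alpha_{\min},\alpha_{\max}]$, set $\alpha=\alpha_t^0$, pick any $\xi_i^t\in P_{D_i}(x^t)$ for $i=1,\dots,m$, and set $g^t:=2\sum_{i=1}^m\psi_+'(d_{D_i}^2(x^t))(x^t-\xi_i^t)$. Inner loop: choose any $\tilde u\in\operatorname{arg\,min}_{u\in C}\{\langle g^t,u-x^t\rangle+\frac1{2\alpha}\|u-x^t\|^2\}$; if $\Psi(\tilde u)-\max_{\max\{t-M,0\}\le i\le t}\Psi(x^i)\le-\frac\sigma2\|\tilde u-x^t\|^2$, set $\alpha_t:=\alpha$, $x^{t+1}:=\tilde u$ and pass to the next $t$; otherwise replace $\alpha$ by $\eta\alpha$ and repeat the inner loop. *)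

theory Defs
  imports "HOL-Analysis.Analysis"
begin

definition right_deriv :: "(real \<Rightarrow> real) \<Rightarrow> real \<Rightarrow> real" where
  "right_deriv \<psi> s = vector_derivative \<psi> (at_right s)"

text \<open>A function on the nonnegative reals is represented by a total function on the reals whose
  values at negative arguments are irrelevant; every clause below depends only on its values on
  \<^term>\<open>{0::real..}\<close>.  The right derivative exists at every point of that set: at 0 this
  follows from continuity at 0 and the existence of the limit of the derivative.\<close>

definition Theta :: "(real \<Rightarrow> real) set" where
  "Theta = {\<psi>.
     (\<forall>s\<ge>0. \<psi> s \<ge> 0) \<and>
     (\<forall>\<gamma>. bounded {s. s \<ge> 0 \<and> \<psi> s \<le> \<gamma>}) \<and>
     continuous_on {0..} \<psi> \<and>
     concave_on {0..} \<psi> \<and>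
     (\<forall>s>0. \<psi> differentiable (at s) \<and> deriv \<psi> s > 0) \<and>
     continuous_on {0<..} (deriv \<psi>) \<and>
     \<psi> 0 = 0 \<and>
     (\<exists>l>0. (deriv \<psi> \<longlongrightarrow> l) (at_right 0)) \<and>
     (\<exists>L. L-lipschitz_on {0..} (right_deriv \<psi>))}"

definition proj_set :: "'a::euclidean_space set \<Rightarrow> 'a \<Rightarrow> 'a set" where
  "proj_set D x = {y \<in> D. norm (x - y) = infdist x D}"

text \<open>Following Rockafellar and Wets, a scalar sequence decreases to 0 if it is positive and
  converges to 0; requiring monotonicity as well would give the same cone, by passing to
  subsequences.\<close>

definition horizon_cone :: "'a::euclidean_space set \<Rightarrow> 'a set" where
  "horizon_cone D = {x. \<exists>(X :: nat \<Rightarrow> 'a) (l :: nat \<Rightarrow> real).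
     (\<forall>t. X t \<in> D) \<and> (\<forall>t. l t > 0) \<and> l \<longlonglongrightarrow> 0 \<and> (\<lambda>t. l t *\<^sub>R X t) \<longlonglongrightarrow> x}"

definition indicator_fun :: "'a set \<Rightarrow> 'a \<Rightarrow> ereal" where
  "indicator_fun C x = (if x \<in> C then 0 else \<infinity>)"

text \<open>The subdifferentials are meant for proper functions, that is, functions that never take the
  value \<^term>\<open>- \<infinity> :: ereal\<close> and are not identically \<^term>\<open>\<infinity> :: ereal\<close>; they are empty at
  points where the function is infinite.\<close>

definition regular_subdiff :: "('a::euclidean_space \<Rightarrow> ereal) \<Rightarrow> 'a \<Rightarrow> 'a set" where
  "regular_subdiff f x = {v. \<bar>f x\<bar> \<noteq> \<infinity> \<and>
     Liminf (at x) (\<lambda>y. (f y - f x - ereal (v \<bullet> (y - x))) / ereal (norm (y - x))) \<ge> 0}"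

definition limiting_subdiff :: "('a::euclidean_space \<Rightarrow> ereal) \<Rightarrow> 'a \<Rightarrow> 'a set" where
  "limiting_subdiff f x = {v. \<bar>f x\<bar> \<noteq> \<infinity> \<and>
     (\<exists>(X :: nat \<Rightarrow> 'a) (V :: nat \<Rightarrow> 'a).
        X \<longlonglongrightarrow> x \<and> (\<lambda>t. f (X t)) \<longlonglongrightarrow> f x \<and>
        (\<forall>t. V t \<in> regular_subdiff f (X t)) \<and> V \<longlonglongrightarrow> v)}"

definition normal_cone :: "'a::euclidean_space set \<Rightarrow> 'a \<Rightarrow> 'a set" where
  "normal_cone C x = limiting_subdiff (indicator_fun C) x"

definition Psi :: "(real \<Rightarrow> real) \<Rightarrow> nat \<Rightarrow> (nat \<Rightarrow> 'a::euclidean_space set) \<Rightarrow> 'a \<Rightarrow> real" where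
  "Psi \<psi> m D x = (\<Sum>i=1..m. \<psi> ((infdist x (D i))\<^sup>2))"

text \<open>The sums of sets below are Minkowski sums.\<close>

definition stationary_point ::
  "(real \<Rightarrow> real) \<Rightarrow> nat \<Rightarrow> (nat \<Rightarrow> 'a::euclidean_space set) \<Rightarrow> 'a set \<Rightarrow> 'a \<Rightarrow> bool" where
  "stationary_point \<psi> m D C x \<longleftrightarrow> x \<in> C \<and>
     0 \<in> (\<Sum>i=1..m. (\<lambda>p. (2 * right_deriv \<psi> ((infdist x (D i))\<^sup>2)) *\<^sub>R (x - p)) ` proj_set (D i) x)
          + normal_cone C x"

text \<open>\<open>line_search C g x acc \<eta> a b u\<close>: the inner loop at the iterate \<open>x\<close> with search vector \<open>g\<close> and
  acceptance test \<open>acc\<close>, entered with step size \<open>a\<close>, can terminate with step size \<open>b\<close> and accepted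
  point \<open>u\<close>.  The minimizer is chosen afresh, arbitrarily, for each trial step size.\<close>

inductive line_search ::
  "'a::euclidean_space set \<Rightarrow> 'a \<Rightarrow> 'a \<Rightarrow> ('a \<Rightarrow> bool) \<Rightarrow> real \<Rightarrow> real \<Rightarrow> real \<Rightarrow> 'a \<Rightarrow> bool"
  for C g x acc \<eta> where
  accept: "is_arg_min (\<lambda>v. g \<bullet> (v - x) + 1 / (2 * a) * (norm (v - x))\<^sup>2) (\<lambda>v. v \<in> C) u \<Longrightarrow>
     acc u \<Longrightarrow> line_search C g x acc \<eta> a a u"
| reject: "is_arg_min (\<lambda>v. g \<bullet> (v - x) + 1 / (2 * a) * (norm (v - x))\<^sup>2) (\<lambda>v. v \<in> C) w \<Longrightarrow>
     \<not> acc w \<Longrightarrow> line_search C g x acc \<eta> (\<eta> * a) b u \<Longrightarrow> line_search C g x acc \<eta> a b u"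

definition search_vector ::
  "(real \<Rightarrow> real) \<Rightarrow> nat \<Rightarrow> (nat \<Rightarrow> 'a::euclidean_space set) \<Rightarrow> 'a \<Rightarrow> (nat \<Rightarrow> 'a) \<Rightarrow> 'a" where
  "search_vector \<psi> m D x p =
     2 *\<^sub>R (\<Sum>i=1..m. right_deriv \<psi> ((infdist x (D i))\<^sup>2) *\<^sub>R (x - p i))"

text \<open>In the acceptance test, truncated subtraction makes \<^term>\<open>t - M\<close> the maximum of the
  difference and 0.\<close>

definition sGP_ls ::
  "(real \<Rightarrow> real) \<Rightarrow> nat \<Rightarrow> (nat \<Rightarrow> 'a::euclidean_space set) \<Rightarrow> 'a set \<Rightarrow>
   real \<Rightarrow> real \<Rightarrow> real \<Rightarrow> real \<Rightarrow> nat \<Rightarrow>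
   (nat \<Rightarrow> 'a) \<Rightarrow> (nat \<Rightarrow> real) \<Rightarrow> (nat \<Rightarrow> nat \<Rightarrow> 'a) \<Rightarrow> bool" where
  "sGP_ls \<psi> m D C \<alpha>min \<alpha>max \<eta> \<sigma> M x \<alpha> \<xi> \<longleftrightarrow>
     x 0 \<in> C \<and>
     (\<forall>t. (\<forall>i\<in>{1..m}. \<xi> i t \<in> proj_set (D i) (x t)) \<and>
        (\<exists>\<alpha>0\<in>{\<alpha>min..\<alpha>max}.
           line_search C (search_vector \<psi> m D (x t) (\<lambda>i. \<xi> i t)) (x t)
             (\<lambda>u. Psi \<psi> m D u - (MAX i\<in>{t - M..t}. Psi \<psi> m D (x i))
                    \<le> - (\<sigma> / 2) * (norm (u - x t))\<^sup>2)
             \<eta> \<alpha>0 (\<alpha> t) (x (Suc t))))"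

end

theory Submission
  imports Defs
begin

text \<open>Concavity of \<open>\<psi>\<close> yields a global descent inequality for \<open>Psi\<close> with a fixed quadratic constant,
  although \<open>Psi\<close> need not be differentiable. Hence every sufficiently small step size is accepted,
  so the step sizes stay away from 0, and the iterates stay in an initial sublevel set, which is bounded
  by the horizon cone condition. The window maxima of the objective values decrease to a limit;
  going back step by step from the indices attaining them shows that the steps vanish and that all values
  converge. Minimality of each accepted point makes \<open>- g - (x (Suc t) - x t) / \<alpha> t\<close> a proximal
  normal to \<open>C\<close>, and stationarity follows by passing to the limit along a subsequence on which
  the projections converge too.\<close>

subsection \<open>The scalar function\<close>

lemma Theta_has_field_derivative:
  assumes "\<psi> \<in> Theta" "0 < s"
  shows "(\<psi> has_field_derivative right_deriv \<psi> s) (at s)"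
proof -
  have d: "(\<psi> has_field_derivative deriv \<psi> s) (at s)"
    using assms by (simp add: Theta_def DERIV_deriv_iff_real_differentiable)
  then have "(\<psi> has_vector_derivative deriv \<psi> s) (at_right s)"
    using has_real_derivative_iff_has_vector_derivative has_field_derivative_at_within by blast
  then have "right_deriv \<psi> s = deriv \<psi> s"
    unfolding right_deriv_def by (intro vector_derivative_within) auto
  with d show ?thesis by simp
qed

lemma Theta_continuous_on_right_deriv:
  assumes "\<psi> \<in> Theta"
  shows "continuous_on {0..} (right_deriv \<psi>)"
  using assms by (auto simp: Theta_def intro: lipschitz_on_continuous_on)

lemma Theta_right_deriv_tendsto_0:
  assumes "\<psi> \<in> Theta"
  shows "(right_deriv \<psi> \<longlongrightarrow> right_deriv \<psi> 0) (at_right 0)"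
proof -
  have "(right_deriv \<psi> \<longlongrightarrow> right_deriv \<psi> 0) (at 0 within {0..})"
    using Theta_continuous_on_right_deriv[OF assms] by (simp add: continuous_on_def)
  then show ?thesis
    by (rule tendsto_within_subset) auto
qed

text \<open>Only the value at 0 needs an argument: on the positive axis
  \<open>right_deriv \<psi>\<close> is \<open>deriv \<psi>\<close>, and being Lipschitz it is
  continuous at 0, so its value there is the positive limit of the derivative.\<close>

lemma Theta_right_deriv_pos:
  assumes "\<psi> \<in> Theta" "0 \<le> s"
  shows "0 < right_deriv \<psi> s"
proof -
  have eq: "right_deriv \<psi> s = deriv \<psi> s" if "0 < s" for s
    using Theta_has_field_derivative[OF assms(1) that] by (simp add: DERIV_imp_deriv)
  show ?thesis
  proof (cases "s = 0")
    case True
    from assms(1) obtain l where l: "0 < l" "(deriv \<psi> \<longlongrightarrow> l) (at_right 0)"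
      by (auto simp: Theta_def)
    have "\<forall>\<^sub>F s in at_right 0. deriv \<psi> s = right_deriv \<psi> s"
      using eq by (auto simp: eventually_at_filter)
    with l(2) have "(right_deriv \<psi> \<longlongrightarrow> l) (at_right 0)"
      by (rule Lim_transform_eventually)
    with Theta_right_deriv_tendsto_0[OF assms(1)] have "right_deriv \<psi> 0 = l"
      using tendsto_unique trivial_limit_at_right_real by blast
    with l True show ?thesis by simp
  next
    case False
    then show ?thesis using assms eq by (simp add: Theta_def)
  qed
qed

text \<open>For \<open>0 < a\<close> this is the supporting line of the convex function
  \<open>- \<psi>\<close>. The case \<open>a = 0\<close> follows by letting positive
  \<open>a\<close> decrease to 0, since \<open>\<psi>\<close> and \<open>right_deriv \<psi>\<close>
  are both right-continuous there.\<close>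

lemma Theta_above_tangent:
  assumes "\<psi> \<in> Theta" "0 \<le> a" "0 \<le> b"
  shows "\<psi> b \<le> \<psi> a + right_deriv \<psi> a * (b - a)"
proof -
  have pos: "\<psi> b \<le> \<psi> a + right_deriv \<psi> a * (b - a)" if "0 < a" for a
  proof -
    have cvx: "convex_on {0..} (\<lambda>s. - \<psi> s)"
      using assms(1) by (simp add: Theta_def concave_on_def)
    have der: "((\<lambda>s. - \<psi> s) has_field_derivative - right_deriv \<psi> a) (at a within {0..})"
      using DERIV_minus[OF has_field_derivative_at_within[OF Theta_has_field_derivative[OF assms(1) that]]] .
    have "- right_deriv \<psi> a * (b - a) \<le> - \<psi> b - - \<psi> a"
      by (rule convex_on_imp_above_tangent[OF cvx connected_Ici _ _ der]) (use assms(3) that in simp_all)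
    then show ?thesis by simp
  qed
  show ?thesis
  proof (cases "a = 0")
    case True
    have "continuous_on {0..} \<psi>" using assms(1) by (simp add: Theta_def)
    then have "(\<psi> \<longlongrightarrow> \<psi> 0) (at 0 within {0..})"
      by (simp add: continuous_on_def)
    then have "(\<psi> \<longlongrightarrow> \<psi> 0) (at_right 0)"
      by (rule tendsto_within_subset) auto
    then have "((\<lambda>a. \<psi> a + right_deriv \<psi> a * (b - a)) \<longlongrightarrow> \<psi> 0 + right_deriv \<psi> 0 * (b - 0)) (at_right 0)"
      by (intro tendsto_intros Theta_right_deriv_tendsto_0[OF assms(1)])
    then have "\<psi> b \<le> \<psi> 0 + right_deriv \<psi> 0 * (b - 0)"
      by (rule tendsto_lowerbound) (use pos in \<open>auto simp: eventually_at_filter\<close>)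
    with True show ?thesis by simp
  qed (use assms pos in auto)
qed

text \<open>Adding the tangent inequalities at \<open>a\<close> and at 0 cancels the values of
  \<open>\<psi>\<close>. This is what makes the quadratic constant of the descent inequality
  independent of the base point.\<close>

lemma Theta_right_deriv_le_0:
  assumes "\<psi> \<in> Theta" "0 \<le> a"
  shows "right_deriv \<psi> a \<le> right_deriv \<psi> 0"
proof (cases "a = 0")
  case False
  have "right_deriv \<psi> a * a \<le> right_deriv \<psi> 0 * a"
    using Theta_above_tangent[of \<psi> a 0] Theta_above_tangent[of \<psi> 0 a] assms by simp
  with False assms show ?thesis by simp
qed simp

subsection \<open>The objective function\<close>

lemma Psi_nonneg: "\<psi> \<in> Theta \<Longrightarrow> 0 \<le> Psi \<psi> m D x"
  by (auto simp: Psi_def Theta_def intro: sum_nonneg)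

lemma continuous_on_Psi:
  assumes "\<psi> \<in> Theta"
  shows "continuous_on S (Psi \<psi> m D)"
proof -
  have "continuous_on {0..} \<psi>" using assms by (simp add: Theta_def)
  then have "continuous_on S (\<lambda>x. \<psi> ((infdist x (D i))\<^sup>2))" for i
    by (rule continuous_on_compose2) (auto intro!: continuous_intros)
  then show ?thesis
    unfolding Psi_def by (intro continuous_on_sum)
qed

text \<open>Every summand of \<open>Psi\<close> is nonnegative, so each is at most
  \<open>\<gamma>\<close>, and level-boundedness of \<open>\<psi>\<close> then bounds the squared
  distance.\<close>

lemma infdist_bounded_on_sublevel:
  assumes "\<psi> \<in> Theta"
  obtains B where "\<And>x i. Psi \<psi> m D x \<le> \<gamma> \<Longrightarrow> i \<in> {1..m} \<Longrightarrow> infdist x (D i) \<le> B"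
proof -
  have "bounded {s. s \<ge> 0 \<and> \<psi> s \<le> \<gamma>}" using assms by (simp add: Theta_def)
  then obtain R where R: "\<And>s. 0 \<le> s \<Longrightarrow> \<psi> s \<le> \<gamma> \<Longrightarrow> s \<le> R"
    by (force simp: bounded_iff)
  have "infdist x (D i) \<le> sqrt R" if "Psi \<psi> m D x \<le> \<gamma>" "i \<in> {1..m}" for x i
  proof -
    have "\<psi> ((infdist x (D i))\<^sup>2) \<le> Psi \<psi> m D x"
      unfolding Psi_def using assms that(2) by (intro member_le_sum) (auto simp: Theta_def)
    with that R show ?thesis by (intro real_le_rsqrt) auto
  qed
  then show ?thesis by (rule that)
qed

text \<open>The squared distance to \<open>D i\<close> is at most the squared distance to a fixed projection point,
  and \<open>\<psi>\<close> lies below its tangents, whose slopes lie between 0 and \<open>right_deriv \<psi> 0\<close>.\<close>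

lemma Psi_descent:
  assumes "\<psi> \<in> Theta" and p: "\<And>i. i \<in> {1..m} \<Longrightarrow> p i \<in> proj_set (D i) x"
  shows "Psi \<psi> m D u \<le> Psi \<psi> m D x + search_vector \<psi> m D x p \<bullet> (u - x)
    + real m * right_deriv \<psi> 0 * (norm (u - x))\<^sup>2"
proof -
  let ?w = "\<lambda>i. right_deriv \<psi> ((infdist x (D i))\<^sup>2)"
  have "\<psi> ((infdist u (D i))\<^sup>2) \<le> \<psi> ((infdist x (D i))\<^sup>2)
      + 2 * (?w i *\<^sub>R (x - p i) \<bullet> (u - x)) + right_deriv \<psi> 0 * (norm (u - x))\<^sup>2"
    if i: "i \<in> {1..m}" for i
  proof -
    have pi: "p i \<in> D i" "norm (x - p i) = infdist x (D i)"
      using p[OF i] by (auto simp: proj_set_def)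
    have "infdist u (D i) \<le> norm (u - p i)"
      using infdist_le[OF pi(1), of u] by (simp add: dist_norm)
    then have "(infdist u (D i))\<^sup>2 \<le> (norm (u - p i))\<^sup>2"
      by (simp add: infdist_nonneg)
    also have "\<dots> = (norm ((x - p i) + (u - x)))\<^sup>2" by simp
    also have "\<dots> = (norm (x - p i))\<^sup>2 + 2 * ((x - p i) \<bullet> (u - x)) + (norm (u - x))\<^sup>2"
      by (simp only: power2_norm_eq_inner inner_add_left inner_add_right
          inner_commute[of "u - x" "x - p i"])
    finally have d: "(infdist u (D i))\<^sup>2 - (infdist x (D i))\<^sup>2
      \<le> 2 * ((x - p i) \<bullet> (u - x)) + (norm (u - x))\<^sup>2" using pi by simp
    have "\<psi> ((infdist u (D i))\<^sup>2) \<le> \<psi> ((infdist x (D i))\<^sup>2)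
        + ?w i * ((infdist u (D i))\<^sup>2 - (infdist x (D i))\<^sup>2)"
      by (rule Theta_above_tangent) (use assms in auto)
    also have "?w i * ((infdist u (D i))\<^sup>2 - (infdist x (D i))\<^sup>2)
        \<le> ?w i * (2 * ((x - p i) \<bullet> (u - x)) + (norm (u - x))\<^sup>2)"
      by (rule mult_left_mono[OF d]) (use Theta_right_deriv_pos[OF assms(1)] in \<open>simp add: less_imp_le\<close>)
    also have "\<dots> = 2 * (?w i *\<^sub>R (x - p i) \<bullet> (u - x)) + ?w i * (norm (u - x))\<^sup>2"
      by (simp add: algebra_simps)
    also have "?w i * (norm (u - x))\<^sup>2 \<le> right_deriv \<psi> 0 * (norm (u - x))\<^sup>2"
      by (intro mult_right_mono Theta_right_deriv_le_0) (use assms in auto)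
    finally show ?thesis by simp
  qed
  then have "Psi \<psi> m D u \<le> (\<Sum>i=1..m. \<psi> ((infdist x (D i))\<^sup>2)
      + 2 * (?w i *\<^sub>R (x - p i) \<bullet> (u - x)) + right_deriv \<psi> 0 * (norm (u - x))\<^sup>2)"
    unfolding Psi_def by (intro sum_mono)
  also have "\<dots> = Psi \<psi> m D x + search_vector \<psi> m D x p \<bullet> (u - x)
      + real m * right_deriv \<psi> 0 * (norm (u - x))\<^sup>2"
    by (simp add: Psi_def search_vector_def sum.distrib inner_sum_left sum_distrib_left)
  finally show ?thesis .
qed

subsection \<open>Horizon cones and boundedness\<close>

text \<open>The bounded difference \<open>X n - Y n\<close> vanishes after scaling by
  \<open>l n\<close>. Thus points that merely stay near \<open>E\<close> still produce horizon
  directions of \<open>E\<close>.\<close>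

lemma horizon_coneI_bounded_distance:
  fixes X Y :: "nat \<Rightarrow> 'a::euclidean_space"
  assumes "\<And>n. Y n \<in> E" "\<And>n. norm (X n - Y n) \<le> B"
    and "\<And>n. 0 < l n" "l \<longlonglongrightarrow> 0" "(\<lambda>n. l n *\<^sub>R X n) \<longlonglongrightarrow> w"
  shows "w \<in> horizon_cone E"
proof -
  have "(\<lambda>n. l n *\<^sub>R (X n - Y n)) \<longlonglongrightarrow> 0"
  proof (rule Lim_null_comparison)
    show "\<forall>\<^sub>F n in sequentially. norm (l n *\<^sub>R (X n - Y n)) \<le> l n * B"
      using assms(2,3) by (intro always_eventually allI) (simp add: less_imp_le mult_left_mono)
    show "(\<lambda>n. l n * B) \<longlonglongrightarrow> 0"
      using tendsto_mult_right[OF assms(4), of B] by simp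
  qed
  from tendsto_diff[OF assms(5) this] have "(\<lambda>n. l n *\<^sub>R Y n) \<longlonglongrightarrow> w"
    by (simp add: algebra_simps)
  with assms show ?thesis unfolding horizon_cone_def by blast
qed

text \<open>Normalizing an unbounded sequence in the set and extracting a limit gives a unit vector
  that lies in all the horizon cones, contradicting the hypothesis.\<close>

lemma bounded_of_horizon_cones:
  fixes C :: "'a::euclidean_space set"
  assumes hz: "horizon_cone C \<inter> (\<Inter>i\<in>I. horizon_cone (D i)) = {0}"
    and ne: "\<And>i. i \<in> I \<Longrightarrow> D i \<noteq> {}"
  shows "bounded {x \<in> C. \<forall>i\<in>I. infdist x (D i) \<le> B}" (is "bounded ?S")
proof (rule ccontr)
  assume "\<not> bounded ?S"
  then have "\<forall>n. \<exists>x\<in>?S. real (Suc n) < norm x"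
    unfolding bounded_iff by (meson not_le)
  then have "\<exists>X. \<forall>n. X n \<in> ?S \<and> real (Suc n) < norm (X n)"
    by (intro choice) blast
  then obtain X where XS: "\<And>n. X n \<in> ?S" and Xn: "\<And>n. real (Suc n) < norm (X n)"
    by blast
  have Xpos: "0 < norm (X n)" for n using Xn[of n] of_nat_0_le_iff[of "Suc n"] by linarith
  have "\<forall>n. X n /\<^sub>R norm (X n) \<in> sphere 0 1"
    using Xpos by simp
  with compact_sphere[of "0::'a" 1] obtain w r where w: "w \<in> sphere 0 1" and r: "strict_mono r"
    and lim: "((\<lambda>n. X n /\<^sub>R norm (X n)) \<circ> r) \<longlonglongrightarrow> w"
    unfolding compact_def by meson
  let ?l = "\<lambda>n. inverse (norm (X (r n)))"
  have l: "?l \<longlonglongrightarrow> 0"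
  proof -
    have "(\<lambda>n. inverse (norm (X n))) \<longlonglongrightarrow> 0"
    proof (rule tendsto_sandwich[OF _ _ tendsto_const LIMSEQ_inverse_real_of_nat])
      show "\<forall>\<^sub>F n in sequentially. inverse (norm (X n)) \<le> inverse (real (Suc n))"
        using Xn by (intro always_eventually allI le_imp_inverse_le) (auto simp: less_imp_le)
    qed auto
    from LIMSEQ_subseq_LIMSEQ[OF this r] show ?thesis by (simp add: o_def)
  qed
  have lim': "(\<lambda>n. ?l n *\<^sub>R X (r n)) \<longlonglongrightarrow> w" using lim by (simp add: o_def)
  have lpos: "0 < ?l n" for n using Xpos by simp
  have "w \<in> horizon_cone C"
    using XS by (intro horizon_coneI_bounded_distance[OF _ _ lpos l lim', of "X \<circ> r" _ 0]) simp_all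
  moreover have "w \<in> horizon_cone (D i)" if i: "i \<in> I" for i
  proof -
    \<comment> \<open>The slack 1 makes the bound on the infimum strict, so that some point of
      \<open>D i\<close> realizes it.\<close>
    have "\<exists>y\<in>D i. dist (X (r n)) y < B + 1" for n
    proof -
      have "infdist (X (r n)) (D i) < B + 1" using XS[of "r n"] i by force
      then have "(INF y\<in>D i. dist (X (r n)) y) < B + 1"
        using ne[OF i] by (simp add: infdist_def)
      then show ?thesis
        using ne[OF i] cInf_lessD[of "dist (X (r n)) ` D i" "B + 1"] by auto
    qed
    then obtain Y where "\<And>n. Y n \<in> D i" "\<And>n. dist (X (r n)) (Y n) < B + 1" by metis
    then show ?thesis
      by (intro horizon_coneI_bounded_distance[OF _ _ lpos l lim', of Y _ "B + 1"])
        (auto simp: dist_norm less_imp_le)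
  qed
  ultimately have "w = 0" using hz by auto
  with w show False by simp
qed

subsection \<open>Line search\<close>

lemma line_search_result:
  assumes "line_search C g x acc \<eta> a b u"
  shows "is_arg_min (\<lambda>v. g \<bullet> (v - x) + 1 / (2 * b) * (norm (v - x))\<^sup>2) (\<lambda>v. v \<in> C) u" "acc u"
  using assms by (induction rule: line_search.induct) auto

text \<open>A rejected step size exceeds \<open>c\<close>, so the next trial still exceeds
  \<open>\<eta> * c\<close>. The first term of the minimum covers acceptance at the initial
  size.\<close>

lemma line_search_stepsize_ge:
  assumes "line_search C g x acc \<eta> a b u" and "0 < \<eta>" and "0 < a"
    and "\<And>a w. \<lbrakk>0 < a; a \<le> c;
      is_arg_min (\<lambda>v. g \<bullet> (v - x) + 1 / (2 * a) * (norm (v - x))\<^sup>2) (\<lambda>v. v \<in> C) w\<rbrakk> \<Longrightarrow> acc w"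
  shows "min a (\<eta> * c) \<le> b"
  using assms(1,3)
proof (induction rule: line_search.induct)
  case (reject a w b u)
  then have "c < a" using assms(4) by force
  with reject.IH reject.prems assms(2) have "\<eta> * c \<le> b"
    by (smt (verit) mult_less_cancel_left_pos mult_pos_pos)
  then show ?case by simp
qed simp

text \<open>The minimizer is compared with \<open>x\<close> itself, where the model
  vanishes.\<close>

lemma is_arg_min_prox_le:
  fixes x :: "'a::euclidean_space"
  assumes "is_arg_min (\<lambda>v. g \<bullet> (v - x) + 1 / (2 * a) * (norm (v - x))\<^sup>2) (\<lambda>v. v \<in> C) u" "x \<in> C"
  shows "g \<bullet> (u - x) + 1 / (2 * a) * (norm (u - x))\<^sup>2 \<le> 0"
  using assms by (force simp: is_arg_min_linorder)

text \<open>Expanding the model around \<open>u\<close> turns minimality into the proximal normal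
  inequality for \<open>C\<close> at \<open>u\<close>.\<close>

lemma is_arg_min_prox_proximal_normal:
  fixes x :: "'a::euclidean_space"
  assumes min: "is_arg_min (\<lambda>v. g \<bullet> (v - x) + 1 / (2 * a) * (norm (v - x))\<^sup>2) (\<lambda>v. v \<in> C) u"
    and y: "y \<in> C"
  shows "(- g - (1 / a) *\<^sub>R (u - x)) \<bullet> (y - u) \<le> 1 / (2 * a) * (norm (y - u))\<^sup>2"
proof -
  have "g \<bullet> (u - x) + 1 / (2 * a) * (norm (u - x))\<^sup>2 \<le> g \<bullet> (y - x) + 1 / (2 * a) * (norm (y - x))\<^sup>2"
    using assms by (simp add: is_arg_min_linorder)
  moreover have "g \<bullet> (y - x) = g \<bullet> (u - x) + g \<bullet> (y - u)"
    by (simp add: inner_diff_right)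
  moreover have "(norm (y - x))\<^sup>2 = (norm (u - x))\<^sup>2 + 2 * ((u - x) \<bullet> (y - u)) + (norm (y - u))\<^sup>2"
  proof -
    have "(norm (y - x))\<^sup>2 = (norm ((u - x) + (y - u)))\<^sup>2" by simp
    then show ?thesis
      by (simp only: power2_norm_eq_inner inner_add_left inner_add_right
          inner_commute[of "y - u" "u - x"])
  qed
  ultimately have "0 \<le> g \<bullet> (y - u) + 1 / (2 * a) * (2 * ((u - x) \<bullet> (y - u)) + (norm (y - u))\<^sup>2)"
    by (simp only: distrib_left)
  then show ?thesis
    by (simp add: inner_diff_left algebra_simps)
qed

subsection \<open>Nonmonotone descent\<close>

text \<open>Here \<open>\<delta>\<close> stands for the step lengths and \<open>unif\<close> for
  uniform continuity of the objective along the steps. Descent is only relative to the window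
  maximum \<open>F\<close>, so \<open>F\<close> is the monotone quantity.\<close>

lemma nonmonotone_descent:
  fixes f \<delta> :: "nat \<Rightarrow> real"
  assumes c: "0 < c" and bdd: "\<And>t. b \<le> f t"
    and desc: "\<And>t. f (Suc t) \<le> (MAX i\<in>{t - M..t}. f i) - c * (\<delta> t)\<^sup>2"
    and unif: "\<And>e. 0 < e \<Longrightarrow> \<exists>d>0. \<forall>t. \<bar>\<delta> t\<bar> < d \<longrightarrow> \<bar>f (Suc t) - f t\<bar> < e"
  shows "\<delta> \<longlonglongrightarrow> 0" "convergent f"
proof -
  define F where "F = (\<lambda>t. MAX i\<in>{t - M..t}. f i)"
  have f_le: "f i \<le> F t" if "i \<in> {t - M..t}" for i t
    unfolding F_def using that by (intro Max_ge) auto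
  have "\<exists>i. i \<in> {t - M..t} \<and> F t = f i" for t
  proof -
    have "F t \<in> f ` {t - M..t}" unfolding F_def by (intro Max_in) auto
    then show ?thesis by auto
  qed
  then obtain l where l: "\<And>t. l t \<in> {t - M..t}" and Fl: "\<And>t. F t = f (l t)" by metis
  have step: "f (Suc t) + c * (\<delta> t)\<^sup>2 \<le> F t" for t using desc[of t] by (simp add: F_def)
  \<comment> \<open>The new maximum is attained either at the new index, where descent applies, or
    inside the old window.\<close>
  have "F (Suc t) \<le> F t" for t
  proof (cases "l (Suc t) = Suc t")
    case True
    have "0 \<le> c * (\<delta> t)\<^sup>2" using c by simp
    with True Fl[of "Suc t"] step[of t] show ?thesis by simp
  next
    case False
    with l[of "Suc t"] have "l (Suc t) \<in> {t - M..t}" by auto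
    then show ?thesis using Fl f_le by simp
  qed
  then have "decseq F" by (rule decseq_SucI)
  moreover have "b \<le> F t" for t using Fl bdd by simp
  ultimately obtain L where L: "F \<longlonglongrightarrow> L" using decseq_convergent by blast
  \<comment> \<open>Along such indices the decrease below \<open>F\<close> tends to
    \<open>L - L\<close>, and it dominates \<open>c\<close> times the squared step. This is used for
    the indices before \<open>l t\<close> and finally for all indices.\<close>
  have d0: "(\<lambda>t. \<delta> (k t)) \<longlonglongrightarrow> 0"
    if k: "filterlim k at_top sequentially" and fk: "(\<lambda>t. f (Suc (k t))) \<longlonglongrightarrow> L" for k
  proof -
    have "(\<lambda>t. F (k t) - f (Suc (k t))) \<longlonglongrightarrow> L - L"
      by (intro tendsto_diff fk filterlim_compose[OF L k])
    then have "(\<lambda>t. (F (k t) - f (Suc (k t))) / c) \<longlonglongrightarrow> 0"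
      using tendsto_divide_zero by fastforce
    moreover have "\<forall>\<^sub>F t in sequentially. norm ((\<delta> (k t))\<^sup>2) \<le> (F (k t) - f (Suc (k t))) / c"
      using step c by (intro always_eventually) (simp add: field_simps)
    ultimately have "(\<lambda>t. (\<delta> (k t))\<^sup>2) \<longlonglongrightarrow> 0"
      by (rule Lim_null_comparison[rotated])
    then show ?thesis by simp
  qed
  have k: "filterlim (\<lambda>t. l t - j) at_top sequentially" for j
    unfolding filterlim_at_top
  proof
    fix Z
    show "\<forall>\<^sub>F t in sequentially. Z \<le> l t - j"
      using eventually_ge_at_top[of "Z + j + M"]
    proof eventually_elim
      case (elim t)
      then show ?case using l[of t] by auto
    qed
  qed
  \<comment> \<open>Backward induction: a limit at \<open>l t - j\<close> forces the preceding step
    to vanish, and \<open>unif\<close> then carries the limit one index further back.\<close>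
  have fl: "(\<lambda>t. f (l t - j)) \<longlonglongrightarrow> L" for j
  proof (induction j)
    case 0
    then show ?case using L unfolding Fl by simp
  next
    case (Suc j)
    let ?k = "\<lambda>t. l t - Suc j"
    \<comment> \<open>Away from 0, truncated subtraction satisfies
      \<open>Suc (l t - Suc j) = l t - j\<close>.\<close>
    have "\<forall>\<^sub>F t in sequentially. 1 \<le> l t - j"
      using k[of j] unfolding filterlim_at_top by blast
    then have "\<forall>\<^sub>F t in sequentially. f (l t - j) = f (Suc (?k t))"
      by eventually_elim (simp add: Suc_diff_Suc)
    with Suc.IH have fS: "(\<lambda>t. f (Suc (?k t))) \<longlonglongrightarrow> L"
      by (rule Lim_transform_eventually)
    have dk: "(\<lambda>t. \<delta> (?k t)) \<longlonglongrightarrow> 0" by (rule d0[OF k fS])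
    have "(\<lambda>t. f (Suc (?k t)) - f (?k t)) \<longlonglongrightarrow> 0"
    proof (rule tendstoI)
      fix e :: real assume "0 < e"
      from unif[OF this] obtain d where d: "0 < d" "\<And>t. \<bar>\<delta> t\<bar> < d \<Longrightarrow> \<bar>f (Suc t) - f t\<bar> < e"
        by blast
      from tendstoD[OF dk d(1)] show "\<forall>\<^sub>F t in sequentially. dist (f (Suc (?k t)) - f (?k t)) 0 < e"
        by eventually_elim (use d(2) in simp)
    qed
    from tendsto_diff[OF fS this] show ?case by simp
  qed
  \<comment> \<open>The window ending at \<open>t + Suc M\<close> starts at \<open>Suc t\<close>, so
    \<open>Suc t\<close> lies at most \<open>M\<close> places before \<open>l (t + Suc M)\<close>.
    This offset varies with \<open>t\<close>; summing over all offsets up to \<open>M\<close> gives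
    a bound that does not depend on which one occurs.\<close>
  have "(\<lambda>t. f (Suc t) - L) \<longlonglongrightarrow> 0"
  proof (rule Lim_null_comparison[OF always_eventually])
    have "(\<lambda>t. \<Sum>j\<le>M. \<bar>f (l t - j) - L\<bar>) \<longlonglongrightarrow> (\<Sum>j\<le>M. \<bar>L - L\<bar>)"
      by (intro tendsto_intros fl)
    from LIMSEQ_ignore_initial_segment[OF this, of "Suc M"]
    show "(\<lambda>t. \<Sum>j\<le>M. \<bar>f (l (t + Suc M) - j) - L\<bar>) \<longlonglongrightarrow> 0" by simp
    show "\<forall>t. norm (f (Suc t) - L) \<le> (\<Sum>j\<le>M. \<bar>f (l (t + Suc M) - j) - L\<bar>)"
    proof
      fix t
      define j where "j = l (t + Suc M) - Suc t"
      have "j \<in> {..M}" "l (t + Suc M) - j = Suc t"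
        using l[of "t + Suc M"] by (auto simp: j_def)
      then show "norm (f (Suc t) - L) \<le> (\<Sum>j\<le>M. \<bar>f (l (t + Suc M) - j) - L\<bar>)"
        using member_le_sum[of j "{..M}" "\<lambda>j. \<bar>f (l (t + Suc M) - j) - L\<bar>"] by simp
    qed
  qed
  then have fS: "(\<lambda>t. f (Suc t)) \<longlonglongrightarrow> L" by (rule LIM_zero_cancel)
  then show "convergent f" by (auto simp: convergent_def filterlim_sequentially_Suc)
  from d0[OF filterlim_ident fS] show "\<delta> \<longlonglongrightarrow> 0" by simp
qed

subsection \<open>Normal cones and projections\<close>

text \<open>The difference quotient is at least \<open>- (K * norm (y - u))\<close> on
  \<open>C\<close> and infinite off \<open>C\<close>; the lower bound tends to 0.\<close>

lemma proximal_normal_in_regular_subdiff: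
  fixes C :: "'a::euclidean_space set"
  assumes u: "u \<in> C" and v: "\<And>y. y \<in> C \<Longrightarrow> v \<bullet> (y - u) \<le> K * (norm (y - u))\<^sup>2"
  shows "v \<in> regular_subdiff (indicator_fun C) u"
proof -
  let ?q = "\<lambda>y. (indicator_fun C y - indicator_fun C u - ereal (v \<bullet> (y - u))) / ereal (norm (y - u))"
  have "((\<lambda>y. - (K * norm (y - u))) \<longlongrightarrow> - (K * norm (u - u))) (at u)"
    by (intro tendsto_intros)
  then have lim: "((\<lambda>y. ereal (- (K * norm (y - u)))) \<longlongrightarrow> 0) (at u)"
    by (simp add: zero_ereal_def)
  have "0 = Liminf (at u) (\<lambda>y. ereal (- (K * norm (y - u))))"
    by (rule lim_imp_Liminf[symmetric, OF _ lim]) simp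
  also have "\<dots> \<le> Liminf (at u) ?q"
  proof (rule Liminf_mono)
    show "\<forall>\<^sub>F y in at u. ereal (- (K * norm (y - u))) \<le> ?q y"
      unfolding eventually_at_filter
    proof (intro always_eventually allI impI)
      fix y assume "y \<noteq> u"
      then have pos: "0 < norm (y - u)" by simp
      show "ereal (- (K * norm (y - u))) \<le> ?q y"
      proof (cases "y \<in> C")
        case True
        then have "v \<bullet> (y - u) / norm (y - u) \<le> K * norm (y - u)"
          using v[OF True] pos by (simp add: pos_divide_le_eq power2_eq_square mult.assoc)
        with True u pos show ?thesis by (simp add: indicator_fun_def)
      next
        case False
        with u pos show ?thesis by (simp add: indicator_fun_def)
      qed
    qed
  qed
  finally show ?thesis
    using u by (simp add: regular_subdiff_def indicator_fun_def)
qed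

text \<open>The constants \<open>K n\<close> may vary freely, since each is used only to make
  \<open>V n\<close> a regular subgradient at \<open>X n\<close>.\<close>

lemma normal_coneI_proximal:
  fixes C :: "'a::euclidean_space set"
  assumes "closed C" "\<And>n. X n \<in> C" "X \<longlonglongrightarrow> x" "V \<longlonglongrightarrow> v"
    and "\<And>n y. y \<in> C \<Longrightarrow> V n \<bullet> (y - X n) \<le> K n * (norm (y - X n))\<^sup>2"
  shows "v \<in> normal_cone C x"
proof -
  have "x \<in> C" using assms closed_sequentially by blast
  moreover have "\<forall>n. V n \<in> regular_subdiff (indicator_fun C) (X n)"
    using assms by (blast intro: proximal_normal_in_regular_subdiff)
  moreover have "(\<lambda>n. indicator_fun C (X n)) \<longlonglongrightarrow> indicator_fun C x"
    using \<open>x \<in> C\<close> assms(2) by (simp add: indicator_fun_def)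
  moreover have "\<bar>indicator_fun C x\<bar> \<noteq> \<infinity>"
    using \<open>x \<in> C\<close> by (simp add: indicator_fun_def)
  ultimately show ?thesis
    unfolding normal_cone_def limiting_subdiff_def using assms(3,4) by blast
qed

text \<open>Membership passes to the limit because \<open>D\<close> is closed, and the distance
  identity because \<open>infdist\<close> is continuous.\<close>

lemma proj_set_closed_graph:
  assumes "closed D" "\<And>n. p n \<in> proj_set D (X n)" "X \<longlonglongrightarrow> x" "p \<longlonglongrightarrow> q"
  shows "q \<in> proj_set D x"
proof -
  have "q \<in> D" using assms closed_sequentially[of D p q] by (auto simp: proj_set_def)
  moreover have "(\<lambda>n. norm (X n - p n)) \<longlonglongrightarrow> norm (x - q)"
    by (intro tendsto_intros assms)
  moreover have "(\<lambda>n. norm (X n - p n)) \<longlonglongrightarrow> infdist x D"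
    using assms(2) tendsto_infdist[OF assms(3), of D] by (simp add: proj_set_def)
  ultimately show ?thesis
    using LIMSEQ_unique by (auto simp: proj_set_def)
qed

text \<open>Subsequences are extracted successively, one per index; later extractions preserve
  earlier limits.\<close>

lemma bounded_family_convergent_subseq:
  fixes f :: "'i \<Rightarrow> nat \<Rightarrow> 'a::heine_borel"
  assumes "finite I" "\<And>i. i \<in> I \<Longrightarrow> bounded (range (f i))"
  shows "\<exists>r. strict_mono r \<and> (\<forall>i\<in>I. convergent (f i \<circ> r))"
  using assms
proof (induction I rule: finite_induct)
  case empty
  then show ?case using strict_mono_id by auto
next
  case (insert i I)
  then obtain r where r: "strict_mono r" "\<And>i. i \<in> I \<Longrightarrow> convergent (f i \<circ> r)"
    by (metis insertI2)
  have "bounded (range (f i \<circ> r))"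
    using insert.prems[of i] by (auto intro: bounded_subset)
  then obtain l s where s: "strict_mono s" "((f i \<circ> r) \<circ> s) \<longlonglongrightarrow> l"
    using bounded_imp_convergent_subsequence by blast
  have "convergent (f j \<circ> (r \<circ> s))" if "j \<in> insert i I" for j
    using that r(2)[of j] s
    by (auto simp: convergent_def o_assoc intro: LIMSEQ_subseq_LIMSEQ)
  then show ?case using strict_mono_o[OF r(1) s(1)] by blast
qed

subsection \<open>Convergence of the algorithm\<close>

theorem theorem4p3:
  fixes C :: "(real ^ 'n) set" and D :: "nat \<Rightarrow> (real ^ 'n) set" and m :: nat
    and \<psi> :: "real \<Rightarrow> real"
    and \<alpha>min \<alpha>max \<eta> \<sigma> :: real and M :: nat
    and x :: "nat \<Rightarrow> real ^ 'n" and \<alpha> :: "nat \<Rightarrow> real" and \<xi> :: "nat \<Rightarrow> nat \<Rightarrow> real ^ 'n"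
  assumes "closed C" and "C \<noteq> {}"
    and "\<And>i. i \<in> {1..m} \<Longrightarrow> closed (D i)"
    and "\<And>i. i \<in> {1..m} \<Longrightarrow> D i \<noteq> {}"
    and "horizon_cone C \<inter> (\<Inter>i\<in>{1..m}. horizon_cone (D i)) = {0}"
    and "\<psi> \<in> Theta"
    and "0 < \<alpha>min" and "\<alpha>min < \<alpha>max"
    and "0 < \<eta>" and "\<eta> < 1"
    and "0 < \<sigma>"
    and "sGP_ls \<psi> m D C \<alpha>min \<alpha>max \<eta> \<sigma> M x \<alpha> \<xi>"
  shows
    "(bounded (range x) \<and> (\<forall>i\<in>{1..m}. bounded (range (\<xi> i))) \<and> (INF t. \<alpha> t) > 0) \<and>
     ((\<lambda>t. norm (x (Suc t) - x t)) \<longlonglongrightarrow> 0 \<and> convergent (\<lambda>t. Psi \<psi> m D (x t))) \<and>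
     (\<forall>xbar r. strict_mono r \<and> (x \<circ> r) \<longlonglongrightarrow> xbar \<longrightarrow> stationary_point \<psi> m D C xbar)"
proof -
  note closedC = assms(1) and closedD = assms(3) and neD = assms(4) and Th = assms(6)
  let ?f = "\<lambda>t. Psi \<psi> m D (x t)"
  let ?g = "\<lambda>t. search_vector \<psi> m D (x t) (\<lambda>i. \<xi> i t)"
  let ?F = "\<lambda>t. MAX i\<in>{t - M..t}. Psi \<psi> m D (x i)"
  let ?acc = "\<lambda>t u. Psi \<psi> m D u - ?F t \<le> - (\<sigma> / 2) * (norm (u - x t))\<^sup>2"
  let ?min = "\<lambda>t a u. is_arg_min (\<lambda>v. ?g t \<bullet> (v - x t) + 1 / (2 * a) * (norm (v - x t))\<^sup>2) (\<lambda>v. v \<in> C) u"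
  have x0: "x 0 \<in> C"
    and proj: "\<And>t i. i \<in> {1..m} \<Longrightarrow> \<xi> i t \<in> proj_set (D i) (x t)"
    and ls: "\<And>t. \<exists>\<alpha>0\<in>{\<alpha>min..\<alpha>max}. line_search C (?g t) (x t) (?acc t) \<eta> \<alpha>0 (\<alpha> t) (x (Suc t))"
    using assms(12) by (auto simp: sGP_ls_def)
  have min: "?min t (\<alpha> t) (x (Suc t))" and acc: "?acc t (x (Suc t))" for t
    using ls[of t] by (auto dest: line_search_result)
  have xC: "x t \<in> C" for t
    using x0 min by (induction t) (auto simp: is_arg_min_def)
  have fF: "?f t \<le> ?F t" for t by (intro Max_ge) auto

  define K where "K = real m * right_deriv \<psi> 0"
  have K: "0 \<le> K" unfolding K_def using Theta_right_deriv_pos[OF Th] by (simp add: less_imp_le)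
  \<comment> \<open>Chosen so that \<open>1 / (2 * a)\<close> is at least
    \<open>K + \<sigma> / 2\<close> for \<open>0 < a \<le> c\<close>: the proximal term then absorbs
    the descent error and still leaves the decrease required by the test.\<close>
  define c where "c = 1 / (2 * K + \<sigma>)"
  have c: "0 < c" using K assms(11) by (simp add: c_def)
  have accept: "?acc t w" if "0 < a" "a \<le> c" "?min t a w" for t a w
  proof -
    have "Psi \<psi> m D w \<le> ?f t + ?g t \<bullet> (w - x t) + K * (norm (w - x t))\<^sup>2"
      unfolding K_def by (rule Psi_descent[OF Th proj])
    moreover have "?g t \<bullet> (w - x t) + 1 / (2 * a) * (norm (w - x t))\<^sup>2 \<le> 0"
      by (rule is_arg_min_prox_le[OF that(3) xC])
    moreover have "(K + \<sigma> / 2) * (norm (w - x t))\<^sup>2 \<le> 1 / (2 * a) * (norm (w - x t))\<^sup>2"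
    proof (rule mult_right_mono)
      have "(2 * K + \<sigma>) * a \<le> 1"
        using that(2) K assms(11) by (simp add: c_def pos_le_divide_eq mult.commute)
      then show "K + \<sigma> / 2 \<le> 1 / (2 * a)" using that(1) by (simp add: field_simps)
    qed simp
    ultimately show ?thesis using fF[of t] unfolding distrib_right by linarith
  qed
  define \<beta> where "\<beta> = min \<alpha>min (\<eta> * c)"
  have \<beta>: "0 < \<beta>" using c assms by (simp add: \<beta>_def)
  have \<alpha>\<beta>: "\<beta> \<le> \<alpha> t" for t
  proof -
    obtain a where a: "\<alpha>min \<le> a" "line_search C (?g t) (x t) (?acc t) \<eta> a (\<alpha> t) (x (Suc t))"
      using ls[of t] by auto
    have "min a (\<eta> * c) \<le> \<alpha> t"
      by (rule line_search_stepsize_ge[OF a(2) assms(9)]) (use a(1) assms(7) accept in auto)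
    with a(1) show ?thesis by (auto simp: \<beta>_def)
  qed
  have "\<beta> \<le> (INF t. \<alpha> t)" using \<alpha>\<beta> by (intro cINF_greatest) auto
  with \<beta> have INF: "0 < (INF t. \<alpha> t)" by simp

  \<comment> \<open>Strong induction is needed because the test compares with a whole window of
    earlier values.\<close>
  have f0: "?f t \<le> ?f 0" for t
  proof (induction t rule: less_induct)
    case (less t)
    show ?case
    proof (cases t)
      case (Suc s)
      have "0 \<le> \<sigma> / 2 * (norm (x (Suc s) - x s))\<^sup>2" using assms(11) by simp
      with acc[of s] have "?f (Suc s) \<le> ?F s" by simp
      also have "?F s \<le> ?f 0" using less Suc by (intro Max.boundedI) auto
      finally show ?thesis using Suc by simp
    qed simp
  qed
  obtain B where B: "\<And>y i. Psi \<psi> m D y \<le> ?f 0 \<Longrightarrow> i \<in> {1..m} \<Longrightarrow> infdist y (D i) \<le> B"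
    using infdist_bounded_on_sublevel[OF Th] by blast
  have "bounded {y \<in> C. \<forall>i\<in>{1..m}. infdist y (D i) \<le> B}"
    by (rule bounded_of_horizon_cones[OF assms(5) neD])
  then have bx: "bounded (range x)"
    by (rule bounded_subset) (use xC B f0 in auto)
  have b\<xi>: "bounded (range (\<xi> i))" if i: "i \<in> {1..m}" for i
  proof -
    from bx obtain R where R: "\<And>t. norm (x t) \<le> R" by (auto simp: bounded_iff)
    have "norm (\<xi> i t) \<le> R + B" for t
      using proj[OF i, of t] B[OF f0 i, of t] R[of t] norm_triangle_ineq2[of "\<xi> i t" "x t"]
      by (simp add: proj_set_def norm_minus_commute)
    then show ?thesis by (auto simp: bounded_iff)
  qed

  have unif: "\<exists>d>0. \<forall>t. \<bar>norm (x (Suc t) - x t)\<bar> < d \<longrightarrow> \<bar>?f (Suc t) - ?f t\<bar> < e" if "0 < e" for e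
  proof -
    \<comment> \<open>Boundedness of the iterates makes this closure compact, so continuity of
      \<open>Psi\<close> suffices.\<close>
    have "uniformly_continuous_on (closure (range x)) (Psi \<psi> m D)"
      using bx by (intro compact_uniformly_continuous continuous_on_Psi[OF Th]) (simp add: compact_closure)
    from this[unfolded uniformly_continuous_on_def, rule_format, OF that]
    obtain d where d: "0 < d"
      "\<And>y z. y \<in> closure (range x) \<Longrightarrow> z \<in> closure (range x) \<Longrightarrow> dist z y < d
        \<Longrightarrow> dist (Psi \<psi> m D z) (Psi \<psi> m D y) < e" by blast
    moreover have "x t \<in> closure (range x)" for t using closure_subset[of "range x"] by blast
    ultimately show ?thesis by (intro exI[of _ d]) (auto simp: dist_norm)
  qed
  have desc: "?f (Suc t) \<le> ?F t - \<sigma> / 2 * (norm (x (Suc t) - x t))\<^sup>2" for t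
    using acc[of t] by simp
  have \<sigma>2: "0 < \<sigma> / 2" using assms(11) by simp
  note nm = nonmonotone_descent[where f = ?f and \<delta> = "\<lambda>t. norm (x (Suc t) - x t)",
      OF \<sigma>2 Psi_nonneg[OF Th] desc unif]
  have step0: "(\<lambda>t. norm (x (Suc t) - x t)) \<longlonglongrightarrow> 0" by (rule nm)

  have "stationary_point \<psi> m D C xbar" if r: "strict_mono r" and xr: "(x \<circ> r) \<longlonglongrightarrow> xbar" for xbar r
  proof -
    \<comment> \<open>The projections need not converge along \<open>r\<close>, so a common further
      subsequence is taken.\<close>
    have "\<exists>s. strict_mono s \<and> (\<forall>i\<in>{1..m}. convergent ((\<xi> i \<circ> r) \<circ> s))"
      by (rule bounded_family_convergent_subseq) (auto intro: bounded_subset[OF b\<xi>])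
    then obtain s where s: "strict_mono s" "\<And>i. i \<in> {1..m} \<Longrightarrow> convergent ((\<xi> i \<circ> r) \<circ> s)" by blast
    define k where "k = r \<circ> s"
    have k: "strict_mono k" unfolding k_def using r s(1) by (rule strict_mono_o)
    have xk: "(\<lambda>n. x (k n)) \<longlonglongrightarrow> xbar"
      using LIMSEQ_subseq_LIMSEQ[OF xr s(1)] by (simp add: k_def o_def)
    have "\<exists>q. \<forall>i\<in>{1..m}. (\<lambda>n. \<xi> i (k n)) \<longlonglongrightarrow> q i"
      using s(2) by (intro bchoice) (auto simp: k_def o_def convergent_def)
    then obtain q where q: "\<And>i. i \<in> {1..m} \<Longrightarrow> (\<lambda>n. \<xi> i (k n)) \<longlonglongrightarrow> q i" by blast
    have qproj: "q i \<in> proj_set (D i) xbar" if "i \<in> {1..m}" for i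
      using proj_set_closed_graph[OF closedD[OF that] proj[OF that] xk q[OF that]] .
    have dk: "(\<lambda>n. x (Suc (k n)) - x (k n)) \<longlonglongrightarrow> 0"
      using LIMSEQ_subseq_LIMSEQ[OF step0 k] by (simp add: o_def tendsto_norm_zero_iff)
    have xSk: "(\<lambda>n. x (Suc (k n))) \<longlonglongrightarrow> xbar"
      using tendsto_add[OF dk xk] by simp
    define w where "w = (\<lambda>i. (2 * right_deriv \<psi> ((infdist xbar (D i))\<^sup>2)) *\<^sub>R (xbar - q i))"
    have rd: "(\<lambda>n. right_deriv \<psi> ((infdist (x (k n)) (D i))\<^sup>2))
        \<longlonglongrightarrow> right_deriv \<psi> ((infdist xbar (D i))\<^sup>2)" for i
      by (rule continuous_on_tendsto_compose[OF Theta_continuous_on_right_deriv[OF Th]])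
        (auto intro!: tendsto_intros xk)
    have gk: "(\<lambda>n. ?g (k n)) \<longlonglongrightarrow> (\<Sum>i=1..m. w i)"
      unfolding search_vector_def scaleR_sum_right w_def scaleR_scaleR[symmetric]
      by (intro tendsto_intros rd xk q)
    \<comment> \<open>The lower bound \<open>\<beta>\<close> on the step sizes keeps the factor
      bounded while the steps vanish.\<close>
    have "(\<lambda>n. (1 / \<alpha> (k n)) *\<^sub>R (x (Suc (k n)) - x (k n))) \<longlonglongrightarrow> 0"
    proof (rule Lim_null_comparison[OF always_eventually])
      show "\<forall>n. norm ((1 / \<alpha> (k n)) *\<^sub>R (x (Suc (k n)) - x (k n)))
          \<le> 1 / \<beta> * norm (x (Suc (k n)) - x (k n))"
      proof
        fix n
        have "\<bar>1 / \<alpha> (k n)\<bar> \<le> 1 / \<beta>" using \<alpha>\<beta>[of "k n"] \<beta> by (simp add: frac_le)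
        then show "norm ((1 / \<alpha> (k n)) *\<^sub>R (x (Suc (k n)) - x (k n)))
          \<le> 1 / \<beta> * norm (x (Suc (k n)) - x (k n))"
          unfolding norm_scaleR by (rule mult_right_mono) simp
      qed
      show "(\<lambda>n. 1 / \<beta> * norm (x (Suc (k n)) - x (k n))) \<longlonglongrightarrow> 0"
        using tendsto_mult_left[OF tendsto_norm_zero[OF dk], of "1 / \<beta>"] by simp
    qed
    from tendsto_diff[OF tendsto_minus[OF gk] this]
    have "(\<lambda>n. - ?g (k n) - (1 / \<alpha> (k n)) *\<^sub>R (x (Suc (k n)) - x (k n))) \<longlonglongrightarrow> - (\<Sum>i=1..m. w i)"
      by simp
    \<comment> \<open>The proximal normals live at the accepted points \<open>x (Suc (k n))\<close>,
      which also tend to \<open>xbar\<close>.\<close>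
    then have "- (\<Sum>i=1..m. w i) \<in> normal_cone C xbar"
      by (rule normal_coneI_proximal[OF closedC xC xSk]) (rule is_arg_min_prox_proximal_normal[OF min])
    moreover have "(\<Sum>i=1..m. w i) \<in>
        (\<Sum>i=1..m. (\<lambda>p. (2 * right_deriv \<psi> ((infdist xbar (D i))\<^sup>2)) *\<^sub>R (xbar - p)) ` proj_set (D i) xbar)"
      using qproj by (subst set_sum_alt) (auto simp: w_def intro!: exI[of _ w])
    ultimately have "(\<Sum>i=1..m. w i) + - (\<Sum>i=1..m. w i) \<in>
        (\<Sum>i=1..m. (\<lambda>p. (2 * right_deriv \<psi> ((infdist xbar (D i))\<^sup>2)) *\<^sub>R (xbar - p)) ` proj_set (D i) xbar)
        + normal_cone C xbar"
      by (intro set_plus_intro)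
    moreover have "xbar \<in> C" by (rule closed_sequentially[OF closedC xC xk])
    ultimately show ?thesis by (simp add: stationary_point_def)
  qed
  then show ?thesis using bx b\<xi> INF nm by blast
qed

end
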